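(* (i) Let $G$ be a finite undirected graph, $\theta$ an integer weight on the vertices of $G^*$ and $\underline{k}$ a non-negative integer vector in $\mathbb{N}_0^{G^*_1}$ such that the quiver cell $\nabla(G^*,\theta)_{\underline{k}}$ is non-empty. Then there exist a subgraph $H$ of $G$ on the same set of vertices and a weight $\theta'\in\mathbb{Z}^{H^*_0}$ that takes value $1$ on every sink of $H^*$, such that $\nabla(G^*,\theta)_{\underline{k}}$ is integral-affinely equivalent to $\nabla(H^*,\theta')$. Moreover, if $G$ is prime and $\dim(\nabla(G^*,\theta)_{\underline{k}})=\chi(G^* )$, then $H=G$. (ii) Let $d\ge2$ and let $G$ be a prime $3$-regular graph on $2d-2$ vertices. Then every $d$-dimensional quiver cell $\nabla(G^*,\theta)_{\underline{k}}$ is integral-affinely equivalent to $\nabla(G^*,\theta')$ for some weight $\theta'$ that takes value $1$ on every sink of $G^*$, value $-1$ on $d-1$ of the sources of $G^*$ and value $-2$ on the remaining $d-1$ sources.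
   Context: Quivers are finite directed graphs with vertex set $Q_0$ and arrow set $Q_1$ (multiple arrows allowed); an arrow $a$ goes from $a^-$ to $a^+$. For an integer weight $\theta\in\mathbb{Z}^{Q_0}$, the quiver polytope is $$\nabla(Q,\theta)=\{x\in\mathbb{R}^{Q_1}_{\ge 0}\mid \forall v\in Q_0:\ \theta(v)=\sum_{a^+=v}x(a)-\sum_{a^-=v}x(a)\},$$ with lattice $\mathbb{Z}^{Q_1}$. For $\underline{k}\in\mathbb{N}_0^{Q_1}$ the $\underline{k}$-cell is $$\nabla(Q,\theta)_{\underline{k}}=\{x\in\nabla(Q,\theta)\mid \underline{k}(a)\le x(a)\le\underline{k}(a)+1\ \text{for all }a\in Q_1\}.$$ Non-empty cells of quiver polytopes are called quiver cells. For an undirected graph $G$ (multiple edges allowed), $G^*$ is the quiver obtained by placing a valency $2$ sink on each edge of $G$: its vertices are the vertices of $G$ (the "sources" of $G^*$) together with one new vertex for each edge of $G$ (the "sinks" of $G^*$), and each edge $e$ of $G$ is replaced by two arrows, from the endpoints of $e$ to the new vertex of $e$. A graph is prime if it has at least one edge and is not the union of two proper subgraphs having at most one common vertex. A graph is $3$-regular if each vertex has valency $3$. For a quiver $Q$, $\chi(Q)=|Q_1|-|Q_0|+\chi_0(Q)$, with $\chi_0(Q)$ the number of connected components of $Q$. Two lattice polytopes $\nabla_i\subset V_i$ with lattices $M_i\subset V_i$ ($i=1,2$) are integral-affinely equivalent if there is an affine linear isomorphism $\mathrm{AffSpan}(\nabla_1)\to\mathrm{AffSpan}(\nabla_2)$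 mapping $\mathrm{AffSpan}(\nabla_1)\cap M_1$ onto $\mathrm{AffSpan}(\nabla_2)\cap M_2$ and $\nabla_1$ onto $\nabla_2$. *)

theory Defs
  imports "HOL-Analysis.Analysis" "Graph_Theory.Digraph_Component"
begin

text \<open>
  A quiver \<open>Q\<close> is a finite directed multigraph, \<^locale>\<open>fin_digraph\<close>; an arrow \<open>a\<close> goes from
  \<open>tail Q a\<close> to \<open>head Q a\<close>. The space of real vectors indexed by the arrows of \<open>Q\<close> is
  the coordinate subspace of \<open>real ^ 'a\<close> in which all coordinates outside \<open>arcs Q\<close> vanish, so
  that quivers with different arrow sets over the same finite type \<open>'a\<close> can be treated together.
\<close>

definition quiver_lattice :: "('n, 'a::finite) pre_digraph \<Rightarrow> (real ^ 'a) set" where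
  "quiver_lattice Q = {x. (\<forall>a\<in>arcs Q. x $ a \<in> \<int>) \<and> (\<forall>a. a \<notin> arcs Q \<longrightarrow> x $ a = 0)}"

definition quiver_polytope ::
    "('n, 'a::finite) pre_digraph \<Rightarrow> ('n \<Rightarrow> int) \<Rightarrow> (real ^ 'a) set" where
  "quiver_polytope Q \<theta> =
    {x. (\<forall>a. a \<notin> arcs Q \<longrightarrow> x $ a = 0) \<and> (\<forall>a\<in>arcs Q. 0 \<le> x $ a) \<and>
        (\<forall>v\<in>verts Q. real_of_int (\<theta> v) = (\<Sum>a\<in>in_arcs Q v. x $ a) - (\<Sum>a\<in>out_arcs Q v. x $ a))}"

definition quiver_cell ::
    "('n, 'a::finite) pre_digraph \<Rightarrow> ('n \<Rightarrow> int) \<Rightarrow> ('a \<Rightarrow> nat) \<Rightarrow> (real ^ 'a) set" where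
  "quiver_cell Q \<theta> k =
    {x \<in> quiver_polytope Q \<theta>. \<forall>a\<in>arcs Q. real (k a) \<le> x $ a \<and> x $ a \<le> real (k a) + 1}"

text \<open>The connected components of \<open>Q\<close> are the strong components of its symmetrization.\<close>

definition num_components :: "('n, 'a) pre_digraph \<Rightarrow> nat" where
  "num_components Q = card (pre_digraph.sccs (with_proj (mk_symmetric Q)))"

definition quiver_chi :: "('n, 'a) pre_digraph \<Rightarrow> int" where
  "quiver_chi Q = int (card (arcs Q)) - int (card (verts Q)) + int (num_components Q)"

text \<open>
  An undirected multigraph (loops permitted) is represented by a \<^locale>\<open>fin_digraph\<close>: the two
  endpoints of the edge \<open>e\<close> are \<open>tail G e\<close> and \<open>head G e\<close>, and which of them is the tail
  is an arbitrary choice without significance. A loop contributes 2 to the valency of its vertex.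
  Subgraphs are the library's \<^const>\<open>subgraph\<close> (and \<^const>\<open>spanning\<close>, for
  subgraphs on the same set of vertices).
\<close>

definition valency :: "('v, 'e) pre_digraph \<Rightarrow> 'v \<Rightarrow> nat" where
  "valency G v = in_degree G v + out_degree G v"

definition regular3_graph :: "('v, 'e) pre_digraph \<Rightarrow> bool" where
  "regular3_graph G \<longleftrightarrow> (\<forall>v\<in>verts G. valency G v = 3)"

definition prime_graph :: "('v, 'e) pre_digraph \<Rightarrow> bool" where
  "prime_graph G \<longleftrightarrow> arcs G \<noteq> {} \<and>
    \<not> (\<exists>H1 H2. subgraph H1 G \<and> H1 \<noteq> G \<and> subgraph H2 G \<and> H2 \<noteq> G \<and>
        union H1 H2 = G \<and> card (verts H1 \<inter> verts H2) \<le> 1)"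

text \<open>
  The quiver \<open>G\<^sup>*\<close>: the source of a vertex \<open>v\<close> is \<open>Inl v\<close>, the sink on an edge \<open>e\<close> is
  \<open>Inr e\<close>, and the two arrows replacing \<open>e\<close> are \<open>(e, False)\<close> and \<open>(e, True)\<close>, one from each
  endpoint of \<open>e\<close>.
\<close>

definition star_quiver :: "('v, 'e) pre_digraph \<Rightarrow> ('v + 'e, 'e \<times> bool) pre_digraph" where
  "star_quiver G =
    \<lparr> verts = Inl ` verts G \<union> Inr ` arcs G,
      arcs = arcs G \<times> UNIV,
      tail = (\<lambda>(e, b). Inl (if b then head G e else tail G e)),
      head = (\<lambda>(e, b). Inr e) \<rparr>"

lemma fin_digraph_star_quiver:
  assumes "fin_digraph G"
  shows "fin_digraph (star_quiver G)"
proof -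
  interpret fin_digraph G by fact
  show ?thesis
    by unfold_locales (auto simp: star_quiver_def)
qed

text \<open>
  Integral-affine equivalence of a lattice polytope \<open>P1\<close> with lattice \<open>M1\<close> and a lattice polytope
  \<open>P2\<close> with lattice \<open>M2\<close>. Only the restriction of \<open>f\<close> to the affine span of \<open>P1\<close> matters.
\<close>

definition integral_affine_equiv ::
    "'a::real_vector set \<Rightarrow> 'a set \<Rightarrow> 'b::real_vector set \<Rightarrow> 'b set \<Rightarrow> bool" where
  "integral_affine_equiv M1 P1 M2 P2 \<longleftrightarrow>
    (\<exists>f. bij_betw f (affine hull P1) (affine hull P2) \<and>
      (\<forall>x\<in>affine hull P1. \<forall>y\<in>affine hull P1. \<forall>t.
        f ((1 - t) *\<^sub>R x + t *\<^sub>R y) = (1 - t) *\<^sub>R f x + t *\<^sub>R f y) \<and>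
      f ` (affine hull P1 \<inter> M1) = affine hull P2 \<inter> M2 \<and>
      f ` P1 = P2)"

end

theory Submission
  imports Defs
begin

text \<open>
  Let \<open>x\<close> be a point of the cell and put \<open>y = x - k\<close>. All coordinates of \<open>y\<close> lie in \<open>[0, 1]\<close>, and the
  two coordinates on an edge \<open>e\<close> add up to an integer that depends only on \<open>\<theta>\<close> and \<open>k\<close>, the slack of
  \<open>e\<close>. Hence the slack is 0, 1 or 2. If it is 0 or 2, both coordinates are forced to be 0 or both
  are forced to be 1, so the edge is rigid. If it is 1, the upper bound \<open>y \<le> 1\<close> follows from
  non-negativity. Translating by \<open>k\<close>, corrected by 1 on the edges of slack 2, thus carries the cell
  onto the polytope of the subgraph formed by the edges of slack 1, with weight 1 on every sink
  (\<open>quiver_cell_translate\<close>). A translation by a lattice vector is an integral-affine equivalence.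

  If \<open>G\<close> is prime, a rigid edge costs a dimension (\<open>aff_dim_constant_coordinate\<close>). The equations that
  define the polytope in \<open>\<real>\<^sup>2\<^sup>E\<close> are one for each edge and one for each vertex. If all vertices but
  one are kept and one coordinate is fixed in addition, a linear relation between these functionals
  amounts to a function on the vertices that takes equal values at the ends of every edge other
  than the edge of the fixed coordinate. Since \<open>G\<close> is prime, removing one edge does not disconnect
  it (\<open>prime_graph_one_edge_cut\<close>), so the function is constant and the relation is trivial. The
  dimension is therefore at most \<open>E - V\<close>, which is less than \<open>\<chi>\<close>. The exception is the graph with two
  vertices and one edge between them: there \<open>\<chi> = 0\<close>, every non-empty cell is a single lattice
  point, and an edge of slack 0 or 2 is treated by choosing the weight directly
  (\<open>quiver_cell_single_bridge\<close>).

  For a cubic graph, double counting gives \<open>E = 3 (d - 1)\<close>, so \<open>E - V = d - 1\<close> and no coordinate is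
  constant on a \<open>d\<close>-dimensional cell. At each source the weight is minus the sum of three
  coordinates in \<open>[0, 1]\<close>. The values 0 and -3 would fix all three coordinates, so only -1 and -2 are
  left, and the total weight \<open>- E\<close> forces each of them to occur \<open>d - 1\<close> times.
\<close>

section \<open>Cuts of prime graphs\<close>

text \<open>
  The negated existential in the definition of primality, turned into a rule in which the two
  covering subgraphs are given by their vertex and edge sets.
\<close>

lemma prime_graph_cover:
  assumes "wf_digraph G" "prime_graph G"
    and "A \<union> B = verts G" "C \<union> D = arcs G" "card (A \<inter> B) \<le> 1"
    and "\<And>e. e \<in> C \<Longrightarrow> tail G e \<in> A \<and> head G e \<in> A"
    and "\<And>e. e \<in> D \<Longrightarrow> tail G e \<in> B \<and> head G e \<in> B"
  shows "A = verts G \<and> C = arcs G \<or> B = verts G \<and> D = arcs G"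
proof (rule ccontr)
  assume neg: "\<not> ?thesis"
  let ?H1 = "\<lparr>verts = A, arcs = C, tail = tail G, head = head G\<rparr>"
  let ?H2 = "\<lparr>verts = B, arcs = D, tail = tail G, head = head G\<rparr>"
  have "subgraph ?H1 G" "subgraph ?H2 G"
    using assms by (auto simp: subgraph_def compatible_def wf_digraph_def)
  moreover have "?H1 \<noteq> G" "?H2 \<noteq> G"
    using neg by (metis pre_digraph.select_convs(1,2))+
  moreover have "union ?H1 ?H2 = G"
    using assms(3,4) by (auto simp: union_def)
  moreover have "card (verts ?H1 \<inter> verts ?H2) \<le> 1"
    using assms(5) by simp
  ultimately show False
    using assms(2) unfolding prime_graph_def by blast
qed

text \<open>
  This is the only shape of a prime graph with a bridge. The bridge is kept as a parameter because
  the lemmas below refer to a specific edge.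
\<close>

definition is_single_bridge :: "('v, 'e) pre_digraph \<Rightarrow> 'e \<Rightarrow> bool" where
  "is_single_bridge G e \<longleftrightarrow>
    arcs G = {e} \<and> verts G = {tail G e, head G e} \<and> tail G e \<noteq> head G e"

text \<open>
  If \<open>e0\<close> joins \<open>W\<close> to its complement, it can be put on either side of the cut, which gives two
  covers of the graph by subgraphs sharing one endpoint of \<open>e0\<close>. Primality applied to both covers
  leaves no room for a second edge or a third vertex. If \<open>e0\<close> does not cross the cut, nothing does,
  and the two sides are disjoint proper subgraphs that cover \<open>G\<close>, contrary to primality.
\<close>

lemma prime_graph_one_edge_cut:
  assumes wf: "wf_digraph G" and prime: "prime_graph G" and e0: "e0 \<in> arcs G"
    and W: "W \<subseteq> verts G" "W \<noteq> {}" "W \<noteq> verts G"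
    and cut: "\<And>e. e \<in> arcs G \<Longrightarrow> e \<noteq> e0 \<Longrightarrow> tail G e \<in> W \<longleftrightarrow> head G e \<in> W"
  shows "is_single_bridge G e0"
proof -
  interpret wf_digraph G by fact
  have crossing: "is_single_bridge G e0" if "x \<in> U" "y \<in> verts G - U" "U \<subseteq> verts G"
    and xy: "{x, y} = {tail G e0, head G e0}"
    and cutU: "\<And>e. e \<in> arcs G \<Longrightarrow> e \<noteq> e0 \<Longrightarrow> tail G e \<in> U \<longleftrightarrow> head G e \<in> U" for x y U
  proof -
    have near: "e = e0 \<or> tail G e \<in> U \<and> head G e \<in> U \<or> tail G e \<in> verts G - U \<and> head G e \<in> verts G - U"
      if "e \<in> arcs G" for e
      using that cutU[OF that] by auto
    have e0xy: "tail G e0 = x \<and> head G e0 = y \<or> tail G e0 = y \<and> head G e0 = x"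
      using xy by (auto simp: doubleton_eq_iff)
    \<comment> \<open>The edge \<open>e0\<close> is counted with \<open>U\<close>; the two parts then share its endpoint \<open>y\<close>.\<close>
    have "U \<union> {y} = verts G \<and> {e \<in> arcs G. tail G e \<in> U \<or> head G e \<in> U} = arcs G \<or>
        verts G - U = verts G \<and> {e \<in> arcs G. tail G e \<notin> U \<and> head G e \<notin> U} = arcs G"
    proof (rule prime_graph_cover[OF wf prime])
      have "(U \<union> {y}) \<inter> (verts G - U) = {y}" using that by auto
      then show "card ((U \<union> {y}) \<inter> (verts G - U)) \<le> 1" by simp
    qed (use that e0xy near in auto)
    then have 1: "verts G \<subseteq> U \<union> {y}" "\<And>e. e \<in> arcs G \<Longrightarrow> tail G e \<in> U \<or> head G e \<in> U"
      using that by auto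
    \<comment> \<open>Now \<open>e0\<close> is counted with the complement of \<open>U\<close>; the two parts share \<open>x\<close>.\<close>
    have "U = verts G \<and> {e \<in> arcs G. tail G e \<in> U \<and> head G e \<in> U} = arcs G \<or>
        (verts G - U) \<union> {x} = verts G \<and> {e \<in> arcs G. tail G e \<notin> U \<or> head G e \<notin> U} = arcs G"
    proof (rule prime_graph_cover[OF wf prime])
      have "U \<inter> ((verts G - U) \<union> {x}) = {x}" using that by auto
      then show "card (U \<inter> ((verts G - U) \<union> {x})) \<le> 1" by simp
    qed (use that e0xy near in auto)
    then have 2: "U \<subseteq> {x}" "\<And>e. e \<in> arcs G \<Longrightarrow> tail G e \<notin> U \<or> head G e \<notin> U"
      using that by auto
    have "verts G = {x, y}"
    proof
      show "verts G \<subseteq> {x, y}" using 1(1) 2(1) by blast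
      show "{x, y} \<subseteq> verts G" using that(1-3) by blast
    qed
    moreover have "arcs G = {e0}" using 1(2) 2(2) near e0 by blast
    moreover have "x \<noteq> y" using that by auto
    ultimately show ?thesis using e0xy unfolding is_single_bridge_def by auto
  qed
  have ends: "tail G e0 \<in> verts G" "head G e0 \<in> verts G" using e0 by auto
  consider "tail G e0 \<in> W" "head G e0 \<notin> W" | "tail G e0 \<notin> W" "head G e0 \<in> W"
    | "tail G e0 \<in> W \<longleftrightarrow> head G e0 \<in> W" by blast
  then show ?thesis
  proof cases
    case 1
    then show ?thesis using crossing[of "tail G e0" W "head G e0"] W cut ends by auto
  next
    case 2
    then show ?thesis using crossing[of "head G e0" W "tail G e0"] W cut ends by auto
  next
    case 3
    then have all: "tail G e \<in> W \<longleftrightarrow> head G e \<in> W" if "e \<in> arcs G" for e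
      using cut[OF that] by auto
    have "W = verts G \<and> {e \<in> arcs G. tail G e \<in> W} = arcs G \<or>
        verts G - W = verts G \<and> {e \<in> arcs G. tail G e \<notin> W} = arcs G"
      by (rule prime_graph_cover[OF wf prime]) (use W all in auto)
    then show ?thesis using W by auto
  qed
qed

section \<open>Dimension of a cell with a constant coordinate\<close>

text \<open>
  The vectors \<open>f i\<close> stand for linear functionals that are constant on \<open>P\<close>. Differences of points of
  \<open>P\<close> lie in the orthogonal complement of their span, whose dimension is the codimension of the
  span. Independence is required of the family, so that distinct indices count separately.
\<close>

lemma aff_dim_le_independent_functionals:
  fixes f :: "'i \<Rightarrow> 'a::euclidean_space"
  assumes fin: "finite I" and ne: "P \<noteq> {}"
    and ind: "\<And>c. (\<Sum>i\<in>I. c i *\<^sub>R f i) = 0 \<Longrightarrow> \<forall>i\<in>I. c i = 0"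
    and const: "\<And>i x y. i \<in> I \<Longrightarrow> x \<in> P \<Longrightarrow> y \<in> P \<Longrightarrow> f i \<bullet> x = f i \<bullet> y"
  shows "aff_dim P + int (card I) \<le> int DIM('a)"
proof -
  have inj: "inj_on f I"
  proof (rule inj_onI, rule ccontr)
    fix i j assume ij: "i \<in> I" "j \<in> I" "f i = f j" "i \<noteq> j"
    let ?c = "\<lambda>l. if l = i then 1 else if l = j then - 1 else 0 :: real"
    have "(\<Sum>l\<in>I. ?c l *\<^sub>R f l) = (\<Sum>l\<in>{i, j}. ?c l *\<^sub>R f l)"
      by (rule sum.mono_neutral_right) (use fin ij in auto)
    also have "\<dots> = 0" using ij by simp
    finally show False using ind[of ?c] ij by auto
  qed
  have indep: "independent (f ` I)"
  proof (rule independent_if_scalars_zero)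
    fix c x assume c: "(\<Sum>x\<in>f ` I. c x *\<^sub>R x) = 0" and x: "x \<in> f ` I"
    have "(\<Sum>i\<in>I. c (f i) *\<^sub>R f i) = 0"
      using c by (simp add: sum.reindex[OF inj])
    then show "c x = 0" using ind[of "\<lambda>i. c (f i)"] x by auto
  qed (use fin in simp)
  define D where "D = {y \<in> UNIV. \<forall>x\<in>span (f ` I). orthogonal x y}"
  have "dim D + dim (span (f ` I)) = dim (UNIV :: 'a set)"
    unfolding D_def by (rule dim_subspace_orthogonal_to_vectors) auto
  moreover have "dim (span (f ` I)) = card I"
    using indep inj by (simp add: dim_eq_card_independent card_image)
  ultimately have dimD: "dim D + card I = DIM('a)" by simp
  obtain p where p: "p \<in> P" using ne by auto
  have "(\<lambda>x. x - p) ` P \<subseteq> D"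
  proof clarify
    fix x assume x: "x \<in> P"
    have "orthogonal (x - p) (f i)" if "i \<in> I" for i
      using const[OF that x p] by (simp add: orthogonal_def inner_diff_right inner_commute[of _ "f i"])
    then have "orthogonal (x - p) v" if "v \<in> span (f ` I)" for v
      by (intro orthogonal_to_span[OF that]) auto
    then show "x - p \<in> D" unfolding D_def by (auto simp: orthogonal_commute)
  qed
  then have "aff_dim ((\<lambda>x. x - p) ` P) \<le> aff_dim D" by (rule aff_dim_subset)
  moreover have "subspace D" unfolding D_def by (auto intro!: subspace_orthogonal_to_vectors)
  ultimately have "aff_dim P \<le> int (dim D)"
    by (simp add: aff_dim_translation_eq_subtract aff_dim_subspace)
  then show ?thesis using dimD by linarith
qed

text \<open>
  The tail of an arrow of \<open>star_quiver G\<close>, read as a vertex of \<open>G\<close>.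
\<close>

definition endpoint :: "('v, 'e) pre_digraph \<Rightarrow> 'e \<times> bool \<Rightarrow> 'v" where
  "endpoint G a = (if snd a then head G (fst a) else tail G (fst a))"

text \<open>
  These are the arrows leaving the source of \<open>v\<close> in \<open>star_quiver G\<close>. A loop at \<open>v\<close> contributes both of
  its arrows, in agreement with the way it counts in the valency.
\<close>

definition arrows_at :: "('v, 'e) pre_digraph \<Rightarrow> 'v \<Rightarrow> ('e \<times> bool) set" where
  "arrows_at G v = {a \<in> arcs G \<times> UNIV. endpoint G a = v}"

lemma endpoint_in_verts:
  assumes "wf_digraph G" "a \<in> arcs G \<times> UNIV"
  shows "endpoint G a \<in> verts G"
  using assms by (auto simp: endpoint_def wf_digraph_def)

lemma arcs_star_quiver [simp]: "arcs (star_quiver G) = arcs G \<times> UNIV"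
  by (simp add: star_quiver_def)

text \<open>
  In \<open>star_quiver G\<close> all arrows leave sources and enter sinks, so that only one of the two sums in
  the flow condition survives at each vertex.
\<close>

lemma in_quiver_polytope_star:
  fixes x :: "real ^ ('e::finite \<times> bool)"
  shows "x \<in> quiver_polytope (star_quiver G) \<theta> \<longleftrightarrow>
    (\<forall>a. a \<notin> arcs G \<times> UNIV \<longrightarrow> x $ a = 0) \<and> (\<forall>a\<in>arcs G \<times> UNIV. 0 \<le> x $ a) \<and>
    (\<forall>e\<in>arcs G. x $ (e, False) + x $ (e, True) = real_of_int (\<theta> (Inr e))) \<and>
    (\<forall>v\<in>verts G. (\<Sum>a\<in>arrows_at G v. x $ a) = - real_of_int (\<theta> (Inl v)))"
proof -
  have out_src: "out_arcs (star_quiver G) (Inl v) = arrows_at G v" for v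
    by (auto simp: out_arcs_def star_quiver_def arrows_at_def endpoint_def)
  have in_src: "in_arcs (star_quiver G) (Inl v) = {}" for v
    by (auto simp: in_arcs_def star_quiver_def)
  have out_snk: "out_arcs (star_quiver G) (Inr e) = {}" for e
    by (auto simp: out_arcs_def star_quiver_def)
  have in_snk: "in_arcs (star_quiver G) (Inr e) = {(e, False), (e, True)}" if "e \<in> arcs G" for e
    using that by (auto simp: in_arcs_def star_quiver_def)
  have verts: "verts (star_quiver G) = Inl ` verts G \<union> Inr ` arcs G"
    by (simp add: star_quiver_def)
  show ?thesis
    unfolding quiver_polytope_def
    by (auto simp: verts ball_Un out_src in_src out_snk in_snk)
qed

lemma in_quiver_cell_star:
  "x \<in> quiver_cell (star_quiver G) \<theta> k \<longleftrightarrow> x \<in> quiver_polytope (star_quiver G) \<theta> \<and>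
    (\<forall>a\<in>arcs G \<times> UNIV. real (k a) \<le> x $ a \<and> x $ a \<le> real (k a) + 1)"
  by (simp add: quiver_cell_def)

text \<open>
  For a connected graph the edge and vertex equations have a single linear relation, namely the sum
  over edges against the sum over vertices; leaving out the vertex \<open>v0\<close> removes it. The functional
  that reads the coordinate \<open>a0\<close> is independent of the others because the graph remains connected
  without the edge of \<open>a0\<close>. The bound \<open>E - V\<close> is the number \<open>2 E\<close> of coordinates minus the number
  \<open>(V - 1) + E + 1\<close> of functionals.
\<close>

lemma aff_dim_constant_coordinate:
  fixes G :: "('v, 'e::finite) pre_digraph"
  assumes G: "fin_digraph G" and prime: "prime_graph G"
    and a0: "a0 \<in> arcs G \<times> UNIV" and nb: "\<not> is_single_bridge G (fst a0)"
    and P: "P \<subseteq> quiver_polytope (star_quiver G) \<theta>" "P \<noteq> {}"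
    and const: "\<And>x y. x \<in> P \<Longrightarrow> y \<in> P \<Longrightarrow> x $ a0 = y $ a0"
  shows "aff_dim P \<le> int (card (arcs G)) - int (card (verts G))"
proof -
  interpret fin_digraph G by fact
  define v0 where "v0 = endpoint G a0"
  have v0: "v0 \<in> verts G" unfolding v0_def using endpoint_in_verts[OF _ a0] wf_digraph_axioms .
  define V where "V = verts G - {v0}"
  \<comment> \<open>The ambient space has coordinates outside the arrows of \<open>G\<close> as well. They vanish on the polytope and are counted as further functionals.\<close>
  define F where "F = insert a0 (UNIV - arcs G \<times> UNIV)"
  define I where "I = (V <+> arcs G) <+> F"
  define f :: "('v + 'e) + ('e \<times> bool) \<Rightarrow> real ^ ('e \<times> bool)" where
    "f = case_sum (case_sum (\<lambda>v. \<chi> a. if a \<in> arrows_at G v then 1 else 0)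
                            (\<lambda>e. \<chi> a. if fst a = e then 1 else 0))
                  (\<lambda>b. \<chi> a. if a = b then 1 else 0)"
  have finV: "finite V" by (simp add: V_def)
  have ind: "\<forall>i\<in>I. c i = 0" if c: "(\<Sum>i\<in>I. c i *\<^sub>R f i) = 0" for c
  proof -
    \<comment> \<open>Setting \<open>\<alpha>\<close> to 0 at the omitted vertex \<open>v0\<close> makes the coefficients of a relation a function on all vertices.\<close>
    define \<alpha> where "\<alpha> v = (if v \<in> V then c (Inl (Inl v)) else 0)" for v
    define \<sigma> where "\<sigma> e = (if e \<in> arcs G then c (Inl (Inr e)) else 0)" for e
    define \<gamma> where "\<gamma> a = (if a \<in> F then c (Inr a) else 0)" for a
    have coord: "(if a \<in> arcs G \<times> UNIV then \<alpha> (endpoint G a) else 0) + \<sigma> (fst a) + \<gamma> a = 0" for a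
    proof -
      have "0 = (\<Sum>i\<in>I. c i *\<^sub>R f i) $ a" using c by simp
      also have "\<dots> = (\<Sum>v\<in>V. c (Inl (Inl v)) * (if a \<in> arrows_at G v then 1 else 0))
          + (\<Sum>e\<in>arcs G. c (Inl (Inr e)) * (if fst a = e then 1 else 0))
          + (\<Sum>b\<in>F. c (Inr b) * (if a = b then 1 else 0))"
        by (simp add: I_def sum.Plus finV f_def)
      also have "(\<Sum>e\<in>arcs G. c (Inl (Inr e)) * (if fst a = e then 1 else 0)) = \<sigma> (fst a)"
        by (simp add: \<sigma>_def if_distrib sum.delta cong: if_cong)
      also have "(\<Sum>b\<in>F. c (Inr b) * (if a = b then 1 else 0)) = \<gamma> a"
        by (simp add: \<gamma>_def if_distrib sum.delta cong: if_cong)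
      also have "(\<Sum>v\<in>V. c (Inl (Inl v)) * (if a \<in> arrows_at G v then 1 else 0)) =
          (\<Sum>v\<in>V. if endpoint G a = v then (if a \<in> arcs G \<times> UNIV then c (Inl (Inl v)) else 0) else 0)"
        by (rule sum.cong) (auto simp: arrows_at_def)
      also have "\<dots> = (if a \<in> arcs G \<times> UNIV then \<alpha> (endpoint G a) else 0)"
        using finV by (simp add: \<alpha>_def)
      finally show ?thesis by simp
    qed
    have \<gamma>0: "\<gamma> a = 0" if "a \<in> arcs G \<times> UNIV" "a \<noteq> a0" for a
      using that by (auto simp: \<gamma>_def F_def)
    \<comment> \<open>Comparing the relation at the two arrows of an edge eliminates the coefficient of the edge.\<close>
    have edge: "\<alpha> (tail G e) = \<alpha> (head G e)" if "e \<in> arcs G" "e \<noteq> fst a0" for e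
    proof -
      have "(e, False) \<noteq> a0" "(e, True) \<noteq> a0" using that by auto
      then show ?thesis
        using coord[of "(e, False)"] coord[of "(e, True)"] \<gamma>0[of "(e, False)"] \<gamma>0[of "(e, True)"] that
        by (simp add: endpoint_def)
    qed
    have \<alpha>0: "\<alpha> v = 0" if v: "v \<in> verts G" for v
    proof (rule ccontr)
      assume "\<alpha> v \<noteq> 0"
      moreover have "\<alpha> v0 = 0" by (simp add: \<alpha>_def V_def)
      ultimately have W: "{v \<in> verts G. \<alpha> v = 0} \<noteq> {}" "{v \<in> verts G. \<alpha> v = 0} \<noteq> verts G"
        using v v0 by auto
      have e0: "fst a0 \<in> arcs G" using a0 by auto
      have "is_single_bridge G (fst a0)"
        using prime_graph_one_edge_cut[OF wf_digraph_axioms prime, of "fst a0" "{v \<in> verts G. \<alpha> v = 0}"]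
          e0 W edge by auto
      then show False using nb by simp
    qed
    have \<sigma>0: "\<sigma> e = 0" if e: "e \<in> arcs G" for e
    proof -
      \<comment> \<open>At least one of the two arrows of \<open>e\<close> is not \<open>a0\<close>, and its coordinate involves \<open>\<sigma> e\<close> alone.\<close>
      obtain b where b: "(e, b) \<noteq> a0"
        by (metis prod.inject)
      then show ?thesis
        using coord[of "(e, b)"] \<gamma>0[of "(e, b)"] \<alpha>0 endpoint_in_verts[OF wf_digraph_axioms, of "(e, b)"] e
        by simp
    qed
    have "\<gamma> a = 0" for a
      using coord[of a] \<alpha>0 \<sigma>0[of "fst a"] endpoint_in_verts[OF wf_digraph_axioms, of a]
      by (cases "fst a \<in> arcs G") (auto simp: \<sigma>_def mem_Times_iff)
    then show ?thesis
      using \<alpha>0 \<sigma>0 unfolding I_def \<alpha>_def \<sigma>_def \<gamma>_def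
      by (auto simp: V_def split: if_splits) metis+
  qed
  have constf: "f i \<bullet> x = f i \<bullet> y" if i: "i \<in> I" and xy: "x \<in> P" "y \<in> P" for i x y
  proof -
    have mem: "x \<in> quiver_polytope (star_quiver G) \<theta>" "y \<in> quiver_polytope (star_quiver G) \<theta>"
      using P xy by auto
    have inner: "(\<chi> a. if Q a then 1 else 0) \<bullet> z = sum (($) z) {a. Q a}"
      for Q and z :: "real ^ ('e \<times> bool)"
      by (simp add: inner_vec_def if_distrib[of "\<lambda>t. t * _"] sum.If_cases cong: if_cong)
    have fibre: "{a. fst a = e} = {(e, False), (e, True)}" for e :: 'e by auto
    consider v where "i = Inl (Inl v)" "v \<in> verts G" | e where "i = Inl (Inr e)" "e \<in> arcs G"
      | a where "i = Inr a" "a \<in> F"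
      using i unfolding I_def V_def by auto
    then show ?thesis
    proof cases
      case 1
      then show ?thesis using mem by (simp add: f_def inner in_quiver_polytope_star)
    next
      case 2
      then show ?thesis using mem by (simp add: f_def inner in_quiver_polytope_star fibre)
    next
      case 3
      then have "x $ a = y $ a"
        using mem const[OF xy] unfolding in_quiver_polytope_star F_def by (metis DiffD2 insertE)
      then show ?thesis using 3 by (simp add: f_def inner)
    qed
  qed
  have finI: "finite I" by (simp add: I_def finV)
  have "aff_dim P + int (card I) \<le> int DIM(real ^ ('e \<times> bool))"
    by (rule aff_dim_le_independent_functionals[OF finI P(2) ind constf])
  moreover have "card I = card V + card (arcs G) + card F"
    by (simp add: I_def finV card_Plus)
  moreover have "card V + 1 = card (verts G)"
    using card_Suc_Diff1[OF finite_verts v0] by (simp add: V_def)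
  moreover have "card F = 1 + card (UNIV - arcs G \<times> (UNIV :: bool set))"
    using a0 by (simp add: F_def)
  moreover have "card (UNIV - arcs G \<times> (UNIV :: bool set)) + 2 * card (arcs G) = 2 * CARD('e)"
    using card_mono[of "UNIV :: 'e set" "arcs G"] by (simp add: card_Diff_subset card_cartesian_product)
  ultimately show ?thesis by simp
qed

section \<open>Translations by lattice vectors\<close>

lemma affine_hull_quiver_polytope_outside:
  assumes "x \<in> affine hull (quiver_polytope Q \<theta>)" "a \<notin> arcs Q"
  shows "x $ a = 0"
proof -
  have "affine hull (quiver_polytope Q \<theta>) \<subseteq> {x. x $ a = 0}"
  proof (rule hull_minimal)
    show "quiver_polytope Q \<theta> \<subseteq> {x. x $ a = 0}"
      using assms(2) by (auto simp: quiver_polytope_def)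
    show "affine {x :: real ^ 'a. x $ a = 0}"
      by (simp add: affine_def)
  qed
  then show ?thesis using assms(1) by auto
qed

text \<open>
  The two lattices may belong to different arrow sets. They correspond under the translation all the
  same, because on the affine hulls the coordinates that are absent from \<open>Q'\<close> are constant, equal to
  those of the lattice vector \<open>z\<close>.
\<close>

lemma integral_affine_equiv_translation:
  assumes z: "z \<in> quiver_lattice Q" and sub: "arcs Q' \<subseteq> arcs Q"
    and image: "(\<lambda>x. x - z) ` P = quiver_polytope Q' \<theta>'"
  shows "integral_affine_equiv (quiver_lattice Q) P (quiver_lattice Q') (quiver_polytope Q' \<theta>')"
  unfolding integral_affine_equiv_def
proof (intro exI[of _ "\<lambda>x. x - z"] conjI ballI allI)
  have hull: "affine hull (quiver_polytope Q' \<theta>') = (\<lambda>x. x - z) ` (affine hull P)"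
    using affine_hull_translation[of "- z" P] image by simp
  then show "bij_betw (\<lambda>x. x - z) (affine hull P) (affine hull (quiver_polytope Q' \<theta>'))"
    by (auto simp: bij_betw_def inj_on_def)
  show "(\<lambda>x. x - z) ` P = quiver_polytope Q' \<theta>'" by (rule image)
  have "x \<in> quiver_lattice Q \<longleftrightarrow> x - z \<in> quiver_lattice Q'" if x: "x \<in> affine hull P" for x
  proof -
    have out: "x $ a - z $ a = 0" if "a \<notin> arcs Q'" for a
      using affine_hull_quiver_polytope_outside[of "x - z" Q' \<theta>' a] hull x that by auto
    show ?thesis
    proof
      assume "x \<in> quiver_lattice Q"
      then show "x - z \<in> quiver_lattice Q'"
        using z out sub by (auto simp: quiver_lattice_def)
    next
      assume xz: "x - z \<in> quiver_lattice Q'"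
      have int: "x $ a - z $ a \<in> \<int>" for a
        using xz out[of a] by (cases "a \<in> arcs Q'") (auto simp: quiver_lattice_def)
      have "x $ a \<in> \<int>" if "a \<in> arcs Q" for a
        using Ints_add[OF int[of a], of "z $ a"] z that by (simp add: quiver_lattice_def)
      moreover have "x $ a = 0" if "a \<notin> arcs Q" for a
        using out[of a] z sub that by (auto simp: quiver_lattice_def)
      ultimately show "x \<in> quiver_lattice Q" by (simp add: quiver_lattice_def)
    qed
  qed
  then show "(\<lambda>x. x - z) ` (affine hull P \<inter> quiver_lattice Q) =
      affine hull (quiver_polytope Q' \<theta>') \<inter> quiver_lattice Q'"
    unfolding hull by auto
qed (simp add: algebra_simps)

section \<open>Removing the rigid edges of a cell\<close>

text \<open>
  The common value on a cell of the sum of the two coordinates of \<open>x - k\<close> at the edge \<open>e\<close>.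
\<close>

definition slack :: "('v + 'e \<Rightarrow> int) \<Rightarrow> ('e \<times> bool \<Rightarrow> nat) \<Rightarrow> 'e \<Rightarrow> int" where
  "slack \<theta> k e = \<theta> (Inr e) - int (k (e, False)) - int (k (e, True))"

definition free_subgraph ::
    "('v, 'e) pre_digraph \<Rightarrow> ('v + 'e \<Rightarrow> int) \<Rightarrow> ('e \<times> bool \<Rightarrow> nat) \<Rightarrow> ('v, 'e) pre_digraph" where
  "free_subgraph G \<theta> k = G\<lparr>arcs := {e \<in> arcs G. slack \<theta> k e = 1}\<rparr>"

text \<open>
  The vector by which the cell is translated. On the edges of slack 2 the upper bounds \<open>k + 1\<close> are
  attained, on all others it is the lower corner \<open>k\<close> of the box.
\<close>

definition corner :: "('v + 'e \<Rightarrow> int) \<Rightarrow> ('e \<times> bool \<Rightarrow> nat) \<Rightarrow> 'e \<times> bool \<Rightarrow> int" where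
  "corner \<theta> k a = int (k a) + (if slack \<theta> k (fst a) = 2 then 1 else 0)"

text \<open>
  Two numbers in \<open>[0, 1]\<close> with an integer sum are both 0 or both 1, unless the sum is 1.
\<close>

lemma quiver_cell_slack:
  fixes x :: "real ^ ('e::finite \<times> bool)"
  assumes x: "x \<in> quiver_cell (star_quiver G) \<theta> k" and e: "e \<in> arcs G"
  shows "slack \<theta> k e \<in> {0, 1, 2}"
    and "slack \<theta> k e \<noteq> 1 \<Longrightarrow> x $ (e, b) = real_of_int (corner \<theta> k (e, b))"
proof -
  let ?y = "\<lambda>b. x $ (e, b) - real (k (e, b))"
  have sum: "?y False + ?y True = real_of_int (slack \<theta> k e)"
    using x e by (auto simp: in_quiver_cell_star in_quiver_polytope_star slack_def)
  have bds: "0 \<le> ?y b" "?y b \<le> 1" for b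
    using x e by (auto simp: in_quiver_cell_star algebra_simps)
  have "real_of_int (slack \<theta> k e) \<ge> 0" "real_of_int (slack \<theta> k e) \<le> 2"
    using sum bds[of False] bds[of True] by linarith+
  then show s: "slack \<theta> k e \<in> {0, 1, 2}" by auto
  assume "slack \<theta> k e \<noteq> 1"
  then consider "slack \<theta> k e = 0" | "slack \<theta> k e = 2" using s by auto
  then show "x $ (e, b) = real_of_int (corner \<theta> k (e, b))"
  proof cases
    case 1
    then have "?y b = 0" using sum bds[of False] bds[of True] by (cases b) auto
    then show ?thesis using 1 by (simp add: corner_def)
  next
    case 2
    then have "?y b = 1" using sum bds[of False] bds[of True] by (cases b) auto
    then show ?thesis using 2 by (simp add: corner_def)
  qed
qed

text \<open>
  Dropping the upper bounds of the cell loses nothing, since on an edge of slack 1 two non-negative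
  coordinates with sum 1 are at most 1. The weights of the sources are corrected by what the
  translation vector contributes. The hypothesis that the cell is non-empty rules out slacks other
  than 0, 1 and 2, for which the translated polytope could be larger than the cell.
\<close>

lemma quiver_cell_translate:
  fixes G :: "('v, 'e::finite) pre_digraph"
  assumes ne: "quiver_cell (star_quiver G) \<theta> k \<noteq> {}"
  defines "H \<equiv> free_subgraph G \<theta> k"
  obtains \<theta>' z where "\<And>e. \<theta>' (Inr e) = 1" and "z \<in> quiver_lattice (star_quiver G)"
    and "(\<lambda>x. x - z) ` quiver_cell (star_quiver G) \<theta> k = quiver_polytope (star_quiver H) \<theta>'"
proof -
  define z :: "real ^ ('e \<times> bool)" where
    "z = (\<chi> a. if a \<in> arcs G \<times> UNIV then real_of_int (corner \<theta> k a) else 0)"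
  define \<theta>' :: "'v + 'e \<Rightarrow> int" where
    "\<theta>' = case_sum (\<lambda>v. \<theta> (Inl v) + (\<Sum>a\<in>arrows_at G v. corner \<theta> k a)) (\<lambda>e. 1)"
  have arcsH: "arcs H = {e \<in> arcs G. slack \<theta> k e = 1}" and vertsH: "verts H = verts G"
    by (auto simp: H_def free_subgraph_def)
  have endH: "endpoint H = endpoint G"
    by (simp add: fun_eq_iff endpoint_def H_def free_subgraph_def)
  have atH: "arrows_at H v \<subseteq> arrows_at G v"
    "a \<in> arrows_at G v - arrows_at H v \<Longrightarrow> a \<notin> arcs H \<times> UNIV"
    for v and a :: "'e \<times> bool"
    using endH by (auto simp: arrows_at_def arcsH)
  have sumG: "(\<Sum>a\<in>arrows_at G v. y $ a) = (\<Sum>a\<in>arrows_at H v. y $ a)"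
    if "\<forall>a. a \<notin> arcs H \<times> UNIV \<longrightarrow> y $ a = 0" for y :: "real ^ ('e \<times> bool)" and v
  proof (rule sum.mono_neutral_right)
    show "\<forall>a\<in>arrows_at G v - arrows_at H v. y $ a = 0" using atH(2) that by blast
  qed (use atH(1) in auto)
  have sumz: "(\<Sum>a\<in>arrows_at G v. z $ a) = real_of_int (\<Sum>a\<in>arrows_at G v. corner \<theta> k a)" for v
    unfolding of_int_sum by (rule sum.cong) (auto simp: z_def arrows_at_def)
  have "(\<lambda>x. x - z) ` quiver_cell (star_quiver G) \<theta> k = quiver_polytope (star_quiver H) \<theta>'"
  proof (intro equalityI subsetI)
    fix y assume "y \<in> (\<lambda>x. x - z) ` quiver_cell (star_quiver G) \<theta> k"
    then obtain x where x: "x \<in> quiver_cell (star_quiver G) \<theta> k" and y: "y = x - z" by auto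
    have out: "\<forall>a. a \<notin> arcs H \<times> UNIV \<longrightarrow> y $ a = 0"
    proof (intro allI impI)
      fix a :: "'e \<times> bool" assume a: "a \<notin> arcs H \<times> UNIV"
      show "y $ a = 0"
      proof (cases "a \<in> arcs G \<times> UNIV")
        case True
        then have "fst a \<in> arcs G" "slack \<theta> k (fst a) \<noteq> 1" using a by (auto simp: arcsH)
        then show ?thesis
          using True quiver_cell_slack(2)[OF x, of "fst a" "snd a"] by (simp add: y z_def)
      next
        case False
        then show ?thesis
          using x by (cases a) (simp add: in_quiver_cell_star in_quiver_polytope_star y z_def)
      qed
    qed
    show "y \<in> quiver_polytope (star_quiver H) \<theta>'"
      unfolding in_quiver_polytope_star
    proof (intro conjI ballI)
      fix a :: "'e \<times> bool" assume "a \<in> arcs H \<times> UNIV"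
      then have a: "a \<in> arcs G \<times> UNIV" "slack \<theta> k (fst a) = 1" by (auto simp: arcsH)
      then have "real (k a) \<le> x $ a" using x unfolding in_quiver_cell_star by blast
      then show "0 \<le> y $ a" using a by (simp add: y z_def corner_def)
    next
      fix e assume "e \<in> arcs H"
      then have e: "e \<in> arcs G" "slack \<theta> k e = 1" by (auto simp: arcsH)
      then have "x $ (e, False) + x $ (e, True) = real_of_int (\<theta> (Inr e))"
        using x unfolding in_quiver_cell_star in_quiver_polytope_star by blast
      also have "\<theta> (Inr e) = 1 + int (k (e, False)) + int (k (e, True))"
        using e(2) by (simp add: slack_def)
      finally show "y $ (e, False) + y $ (e, True) = real_of_int (\<theta>' (Inr e))"
        using e by (simp add: y z_def corner_def \<theta>'_def)
    next
      fix v assume v: "v \<in> verts H"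
      have "(\<Sum>a\<in>arrows_at H v. y $ a) = (\<Sum>a\<in>arrows_at G v. y $ a)"
        using sumG[OF out] by simp
      also have "\<dots> = (\<Sum>a\<in>arrows_at G v. x $ a) - (\<Sum>a\<in>arrows_at G v. z $ a)"
        by (simp add: y sum_subtractf)
      also have "\<dots> = - real_of_int (\<theta>' (Inl v))"
        using x v vertsH by (simp add: in_quiver_cell_star in_quiver_polytope_star sumz \<theta>'_def)
      finally show "(\<Sum>a\<in>arrows_at H v. y $ a) = - real_of_int (\<theta>' (Inl v))" .
    qed (use out in blast)
  next
    fix y assume y: "y \<in> quiver_polytope (star_quiver H) \<theta>'"
    then have out: "\<forall>a. a \<notin> arcs H \<times> (UNIV :: bool set) \<longrightarrow> y $ a = 0"
      and pos: "\<And>e (b :: bool). e \<in> arcs H \<Longrightarrow> 0 \<le> y $ (e, b)"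
      and unit: "\<And>e. e \<in> arcs H \<Longrightarrow> y $ (e, False) + y $ (e, True) = 1"
      and src: "\<And>v. v \<in> verts H \<Longrightarrow> (\<Sum>a\<in>arrows_at H v. y $ a) = - real_of_int (\<theta>' (Inl v))"
      by (auto simp: in_quiver_polytope_star \<theta>'_def)
    have y0: "y $ (e, b) = 0" if "e \<notin> arcs H" for e and b :: bool using out that by simp
    have box: "0 \<le> y $ (e, b) \<and> y $ (e, b) \<le> 1" if "e \<in> arcs H" for e b
      using pos[OF that, of False] pos[OF that, of True] unit[OF that] by (cases b) auto
    \<comment> \<open>The point \<open>x0\<close> serves only to restrict the slack of each edge to 0, 1 or 2.\<close>
    obtain x0 where x0: "x0 \<in> quiver_cell (star_quiver G) \<theta> k" using ne by auto
    have yz: "real (k (e, b)) \<le> y $ (e, b) + z $ (e, b) \<and> y $ (e, b) + z $ (e, b) \<le> real (k (e, b)) + 1"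
      if e: "e \<in> arcs G" for e b
      using box[of e b] y0[of e b] e by (cases "e \<in> arcs H") (auto simp: z_def corner_def arcsH)
    have "y + z \<in> quiver_cell (star_quiver G) \<theta> k"
      unfolding in_quiver_cell_star in_quiver_polytope_star
    proof (intro conjI ballI allI impI)
      fix a assume "a \<notin> arcs G \<times> (UNIV :: bool set)"
      then show "(y + z) $ a = 0" using y0 by (cases a) (simp add: z_def arcsH)
    next
      fix a assume a: "a \<in> arcs G \<times> (UNIV :: bool set)"
      then show "real (k a) \<le> (y + z) $ a" "(y + z) $ a \<le> real (k a) + 1"
        using yz[of "fst a" "snd a"] by auto
      then show "0 \<le> (y + z) $ a" by linarith
    next
      fix e assume e: "e \<in> arcs G"
      show "(y + z) $ (e, False) + (y + z) $ (e, True) = real_of_int (\<theta> (Inr e))"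
        using unit[of e] y0[of e False] y0[of e True] quiver_cell_slack(1)[OF x0 e] e
        by (cases "e \<in> arcs H") (auto simp: z_def corner_def arcsH slack_def)
    next
      fix v assume v: "v \<in> verts G"
      show "(\<Sum>a\<in>arrows_at G v. (y + z) $ a) = - real_of_int (\<theta> (Inl v))"
        using src[of v] v vertsH sumG[OF out, of v] sumz[of v]
        by (simp add: sum.distrib \<theta>'_def)
    qed
    then show "y \<in> (\<lambda>x. x - z) ` quiver_cell (star_quiver G) \<theta> k"
      by (rule rev_image_eqI) simp
  qed
  moreover have "z \<in> quiver_lattice (star_quiver G)"
    by (simp add: quiver_lattice_def z_def)
  moreover have "\<theta>' (Inr e) = 1" for e by (simp add: \<theta>'_def)
  ultimately show thesis using that by blast
qed

section \<open>Full-dimensional cells of prime graphs\<close>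

text \<open>
  Only the lower bound \<open>\<chi> \<ge> E - V + 1\<close> is needed below, and for this it is enough that there is a
  component and that the number of components is finite, so that \<open>card\<close> does not default to 0.
\<close>

lemma num_components_pos:
  assumes "fin_digraph Q" "verts Q \<noteq> {}"
  shows "0 < num_components Q"
proof -
  interpret Q: fin_digraph Q by fact
  let ?S = "with_proj (mk_symmetric Q)"
  interpret S: pair_fin_digraph "mk_symmetric Q" by (rule Q.pair_fin_digraph_mk_symmetric)
  have fin: "fin_digraph ?S" by unfold_locales
  then have wf: "wf_digraph ?S" by (rule fin_digraph.axioms)
  have "finite (pre_digraph.sccs ?S)"
  proof (rule finite_imageD)
    show "finite (verts ` pre_digraph.sccs ?S)"
      using fin_digraph.finite_sccs_verts[OF fin] by (simp add: wf_digraph.sccs_verts_conv[OF wf])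
    show "inj_on verts (pre_digraph.sccs ?S)"
      by (rule inj_onI) (metis pre_digraph.in_sccs_imp_induced wf_digraph.induce_eq_iff_induced[OF wf])
  qed
  moreover have "pre_digraph.sccs ?S \<noteq> {}"
  proof -
    obtain v where "v \<in> verts ?S" using assms(2) by auto
    then have "pre_digraph.scc_of ?S v \<in> pre_digraph.sccs_verts ?S"
      by (rule wf_digraph.scc_of_in_sccs_verts[OF wf])
    then show ?thesis by (auto simp: wf_digraph.sccs_verts_conv[OF wf])
  qed
  ultimately show ?thesis by (simp add: num_components_def card_gt_0_iff)
qed

text \<open>
  On an edge whose slack is not 1 the coordinates of the cell are constant, which would make its
  dimension too small.
\<close>

lemma free_subgraph_eq_if_full_dim:
  fixes G :: "('v, 'e::finite) pre_digraph"
  assumes G: "fin_digraph G" and prime: "prime_graph G"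
    and ne: "quiver_cell (star_quiver G) \<theta> k \<noteq> {}"
    and nb: "\<And>e. \<not> is_single_bridge G e"
    and dim: "aff_dim (quiver_cell (star_quiver G) \<theta> k) > int (card (arcs G)) - int (card (verts G))"
  shows "free_subgraph G \<theta> k = G"
proof -
  have "slack \<theta> k e = 1" if e: "e \<in> arcs G" for e
  proof (rule ccontr)
    assume s: "slack \<theta> k e \<noteq> 1"
    have "aff_dim (quiver_cell (star_quiver G) \<theta> k) \<le> int (card (arcs G)) - int (card (verts G))"
    proof (rule aff_dim_constant_coordinate[OF G prime, of "(e, False)"])
      show "quiver_cell (star_quiver G) \<theta> k \<subseteq> quiver_polytope (star_quiver G) \<theta>"
        by (auto simp: in_quiver_cell_star)
    qed (use e ne nb quiver_cell_slack(2)[OF _ e s] in auto)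
    then show False using dim by simp
  qed
  then have "{e \<in> arcs G. slack \<theta> k e = 1} = arcs G" by auto
  then show ?thesis by (simp add: free_subgraph_def)
qed

text \<open>
  The cell consists of one lattice point. Giving the whole unit of the sink to the tail of the edge
  yields a polytope that consists of one lattice point too, so the equivalence holds without removing
  the edge.
\<close>

lemma quiver_cell_single_bridge:
  fixes G :: "('v, 'e::finite) pre_digraph"
  assumes bridge: "is_single_bridge G e" and s: "slack \<theta> k e \<noteq> 1"
    and x: "x \<in> quiver_cell (star_quiver G) \<theta> k"
  obtains \<theta>' where "\<theta>' (Inr e) = 1" and
    "integral_affine_equiv (quiver_lattice (star_quiver G)) (quiver_cell (star_quiver G) \<theta> k)
      (quiver_lattice (star_quiver G)) (quiver_polytope (star_quiver G) \<theta>')"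
proof -
  have G: "arcs G = {e}" "verts G = {tail G e, head G e}" "tail G e \<noteq> head G e"
    using bridge by (auto simp: is_single_bridge_def)
  have at: "arrows_at G (tail G e) = {(e, False)}" "arrows_at G (head G e) = {(e, True)}"
    using G by (auto simp: arrows_at_def endpoint_def split: if_splits)
  define \<theta>' :: "'v + 'e \<Rightarrow> int" where
    "\<theta>' = case_sum (\<lambda>v. if v = tail G e then - 1 else 0) (\<lambda>_. 1)"
  define p :: "real ^ ('e \<times> bool)" where "p = axis (e, False) 1"
  have poly: "quiver_polytope (star_quiver G) \<theta>' = {p}"
  proof (intro equalityI subsetI)
    fix y assume "y \<in> quiver_polytope (star_quiver G) \<theta>'"
    then have y: "\<And>a. fst a \<noteq> e \<Longrightarrow> y $ a = 0" "y $ (e, False) = 1" "y $ (e, True) = 0"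
      using G(3) by (auto simp: in_quiver_polytope_star G(1,2) at \<theta>'_def)
    have "y $ (e', b) = p $ (e', b)" for e' b
      using y by (cases "e' = e"; cases b) (auto simp: p_def axis_def)
    then show "y \<in> {p}" by (simp add: vec_eq_iff)
  next
    fix y assume "y \<in> {p}"
    then show "y \<in> quiver_polytope (star_quiver G) \<theta>'"
      using G(3) by (auto simp: in_quiver_polytope_star G(1,2) at \<theta>'_def p_def axis_def)
  qed
  have coord: "y $ (e, b) = real_of_int (corner \<theta> k (e, b))" if "y \<in> quiver_cell (star_quiver G) \<theta> k" for y b
    using quiver_cell_slack(2)[OF that _ s] G(1) by auto
  have outside: "y $ a = 0" if "y \<in> quiver_cell (star_quiver G) \<theta> k" "fst a \<noteq> e" for y a
    using that G(1) by (cases a) (simp add: in_quiver_cell_star in_quiver_polytope_star)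
  have "y = x" if y: "y \<in> quiver_cell (star_quiver G) \<theta> k" for y
  proof -
    have "y $ (e', b) = x $ (e', b)" for e' b
      using coord[OF y] coord[OF x] outside[OF y] outside[OF x] by (cases "e' = e") auto
    then show ?thesis by (simp add: vec_eq_iff)
  qed
  then have cell: "quiver_cell (star_quiver G) \<theta> k = {x}" using x by blast
  have "x - p \<in> quiver_lattice (star_quiver G)"
    using coord[OF x] outside[OF x] by (auto simp: G(1) quiver_lattice_def p_def axis_def)
  then have "integral_affine_equiv (quiver_lattice (star_quiver G)) (quiver_cell (star_quiver G) \<theta> k)
      (quiver_lattice (star_quiver G)) (quiver_polytope (star_quiver G) \<theta>')"
    by (rule integral_affine_equiv_translation) (auto simp: cell poly)
  moreover have "\<theta>' (Inr e) = 1" by (simp add: \<theta>'_def)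
  ultimately show thesis using that by blast
qed

text \<open>
  The subgraph is that of the edges of slack 1, except for the graph with a single bridge whose edge
  is rigid. That cell does have dimension \<open>\<chi>\<close>, so the subgraph must be all of \<open>G\<close> there.
\<close>

lemma quiver_cell_equiv_unit_sinks:
  fixes G :: "('v, 'e::finite) pre_digraph"
  assumes G: "fin_digraph G" and ne: "quiver_cell (star_quiver G) \<theta> k \<noteq> {}"
  shows "\<exists>(H :: ('v, 'e) pre_digraph) (\<theta>' :: 'v + 'e \<Rightarrow> int).
    spanning H G \<and> (\<forall>e\<in>arcs H. \<theta>' (Inr e) = 1) \<and>
    integral_affine_equiv
      (quiver_lattice (star_quiver G)) (quiver_cell (star_quiver G) \<theta> k)
      (quiver_lattice (star_quiver H)) (quiver_polytope (star_quiver H) \<theta>') \<and>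
    (prime_graph G \<and> aff_dim (quiver_cell (star_quiver G) \<theta> k) = quiver_chi (star_quiver G)
      \<longrightarrow> H = G)"
proof -
  interpret fin_digraph G by fact
  let ?H = "free_subgraph G \<theta> k"
  have span: "spanning ?H G" "spanning G G"
    using wf_digraph_axioms
    by (auto simp: spanning_def subgraph_def compatible_def free_subgraph_def wf_digraph_def)
  show ?thesis
  proof (cases "\<exists>e. is_single_bridge G e \<and> slack \<theta> k e \<noteq> 1")
    case True
    then obtain e x where e: "is_single_bridge G e" "slack \<theta> k e \<noteq> 1"
      and x: "x \<in> quiver_cell (star_quiver G) \<theta> k" using ne by auto
    from quiver_cell_single_bridge[OF this]
    obtain \<theta>' where "\<theta>' (Inr e) = 1" and
      "integral_affine_equiv (quiver_lattice (star_quiver G)) (quiver_cell (star_quiver G) \<theta> k)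
        (quiver_lattice (star_quiver G)) (quiver_polytope (star_quiver G) \<theta>')" by blast
    moreover have "arcs G = {e}" using e(1) by (simp add: is_single_bridge_def)
    ultimately show ?thesis using span(2) by (intro exI[of _ G] exI[of _ \<theta>']) simp
  next
    case False
    obtain \<theta>' z where \<theta>': "\<And>e. \<theta>' (Inr e) = 1" and z: "z \<in> quiver_lattice (star_quiver G)"
      and im: "(\<lambda>x. x - z) ` quiver_cell (star_quiver G) \<theta> k = quiver_polytope (star_quiver ?H) \<theta>'"
      using quiver_cell_translate[OF ne] by blast
    have "integral_affine_equiv (quiver_lattice (star_quiver G)) (quiver_cell (star_quiver G) \<theta> k)
        (quiver_lattice (star_quiver ?H)) (quiver_polytope (star_quiver ?H) \<theta>')"
      by (rule integral_affine_equiv_translation[OF z _ im]) (auto simp: free_subgraph_def)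
    moreover have "?H = G" if prime: "prime_graph G"
      and dim: "aff_dim (quiver_cell (star_quiver G) \<theta> k) = quiver_chi (star_quiver G)"
    proof (cases "\<exists>e. is_single_bridge G e")
      case True
      then obtain e where "is_single_bridge G e" by blast
      then have "\<forall>e\<in>arcs G. slack \<theta> k e = 1"
        using False by (auto simp: is_single_bridge_def)
      then have "{e \<in> arcs G. slack \<theta> k e = 1} = arcs G" by auto
      then show ?thesis by (simp add: free_subgraph_def)
    next
      case nb: False
      have "arcs G \<noteq> {}" using prime by (simp add: prime_graph_def)
      then have "verts (star_quiver G) \<noteq> {}" by (auto simp: star_quiver_def)
      then have "0 < num_components (star_quiver G)"
        by (rule num_components_pos[OF fin_digraph_star_quiver[OF G]])
      moreover have "card (verts (star_quiver G)) = card (verts G) + card (arcs G)"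
        unfolding star_quiver_def by (simp add: card_Plus flip: Plus_def)
      ultimately have "quiver_chi (star_quiver G) > int (card (arcs G)) - int (card (verts G))"
        by (simp add: quiver_chi_def card_cartesian_product)
      then show ?thesis
        using free_subgraph_eq_if_full_dim[OF G prime ne] nb dim by auto
    qed
    ultimately show ?thesis using span(1) \<theta>' by blast
  qed
qed

section \<open>Cells of cubic graphs\<close>

lemma card_arrows_at:
  assumes "fin_digraph G"
  shows "card (arrows_at G v) = valency G v"
proof -
  interpret fin_digraph G by fact
  have "arrows_at G v = (\<lambda>e. (e, True)) ` in_arcs G v \<union> (\<lambda>e. (e, False)) ` out_arcs G v"
    by (auto simp: arrows_at_def endpoint_def in_arcs_def out_arcs_def split: if_splits)
  moreover have "card ((\<lambda>e. (e, True)) ` in_arcs G v \<union> (\<lambda>e. (e, False)) ` out_arcs G v) =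
      card ((\<lambda>e. (e, True)) ` in_arcs G v) + card ((\<lambda>e. (e, False)) ` out_arcs G v)"
    by (rule card_Un_disjoint) auto
  ultimately show ?thesis
    by (simp add: valency_def in_degree_def out_degree_def card_image inj_on_def)
qed

lemma sum_over_arrows_at:
  fixes g :: "'e::finite \<times> bool \<Rightarrow> 'b::comm_monoid_add"
  assumes "fin_digraph G"
  shows "(\<Sum>v\<in>verts G. \<Sum>a\<in>arrows_at G v. g a) = (\<Sum>e\<in>arcs G. g (e, False) + g (e, True))"
proof -
  interpret fin_digraph G by fact
  have "(\<Sum>v\<in>verts G. \<Sum>a\<in>arrows_at G v. g a) = sum g (arcs G \<times> UNIV)"
    unfolding arrows_at_def
    by (rule sum.group) (use endpoint_in_verts[OF wf_digraph_axioms] in auto)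
  also have "\<dots> = (\<Sum>e\<in>arcs G. \<Sum>b\<in>UNIV. g (e, b))"
    by (simp add: sum.cartesian_product)
  finally show ?thesis by (simp add: UNIV_bool)
qed

lemma quiver_cell_cubic:
  fixes G :: "('v, 'e::finite) pre_digraph"
  assumes d: "2 \<le> d" and G: "fin_digraph G" and prime: "prime_graph G"
    and reg: "regular3_graph G" and cardV: "card (verts G) = 2 * d - 2"
    and dim: "aff_dim (quiver_cell (star_quiver G) \<theta> k) = int d"
  shows "\<exists>(\<theta>' :: 'v + 'e \<Rightarrow> int) S.
    (\<forall>e\<in>arcs G. \<theta>' (Inr e) = 1) \<and>
    S \<subseteq> verts G \<and> card S = d - 1 \<and> card (verts G - S) = d - 1 \<and>
    (\<forall>v\<in>S. \<theta>' (Inl v) = -1) \<and> (\<forall>v\<in>verts G - S. \<theta>' (Inl v) = -2) \<and>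
    integral_affine_equiv
      (quiver_lattice (star_quiver G)) (quiver_cell (star_quiver G) \<theta> k)
      (quiver_lattice (star_quiver G)) (quiver_polytope (star_quiver G) \<theta>')"
proof -
  interpret fin_digraph G by fact
  have at3: "card (arrows_at G v) = 3" if "v \<in> verts G" for v
    using reg that card_arrows_at[OF G] by (simp add: regular3_graph_def)
  have "3 * card (verts G) = 2 * card (arcs G)"
    using sum_over_arrows_at[OF G, of "\<lambda>_. 1 :: nat"] at3 by simp
  then have cardE: "card (arcs G) = 3 * (d - 1)" using cardV by simp
  have nb: "\<not> is_single_bridge G e" for e
    using cardE d by (auto simp: is_single_bridge_def)
  have ne: "quiver_cell (star_quiver G) \<theta> k \<noteq> {}" using dim d by auto
  have H: "free_subgraph G \<theta> k = G"
    by (rule free_subgraph_eq_if_full_dim[OF G prime ne nb]) (use dim cardE cardV d in auto)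
  obtain \<theta>' z where \<theta>': "\<And>e. \<theta>' (Inr e) = 1" and z: "z \<in> quiver_lattice (star_quiver G)"
    and im: "(\<lambda>x. x - z) ` quiver_cell (star_quiver G) \<theta> k = quiver_polytope (star_quiver G) \<theta>'"
    using quiver_cell_translate[OF ne] unfolding H by blast
  let ?P = "quiver_polytope (star_quiver G) \<theta>'"
  have equiv: "integral_affine_equiv (quiver_lattice (star_quiver G)) (quiver_cell (star_quiver G) \<theta> k)
      (quiver_lattice (star_quiver G)) ?P"
    by (rule integral_affine_equiv_translation[OF z _ im]) auto
  have dimP: "aff_dim ?P = int d"
    using dim im aff_dim_translation_eq_subtract[of z "quiver_cell (star_quiver G) \<theta> k"] by simp
  obtain p where p: "p \<in> ?P" using ne im by auto
  \<comment> \<open>With \<open>E - V = d - 1\<close>, a constant coordinate would bring the dimension below \<open>d\<close>.\<close>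
  have varies: "\<not> (\<forall>y\<in>?P. y $ a = t)" if "a \<in> arcs G \<times> UNIV" for a t
  proof
    assume "\<forall>y\<in>?P. y $ a = t"
    then have "aff_dim ?P \<le> int (card (arcs G)) - int (card (verts G))"
      using p by (intro aff_dim_constant_coordinate[OF G prime that nb, of ?P \<theta>']) auto
    then show False using dimP cardE cardV d by auto
  qed
  have box: "0 \<le> y $ a \<and> y $ a \<le> 1" if "y \<in> ?P" "a \<in> arcs G \<times> UNIV" for y a
  proof -
    obtain e b where a: "a = (e, b)" by (cases a)
    have "0 \<le> y $ (e, False)" "0 \<le> y $ (e, True)" "y $ (e, False) + y $ (e, True) = 1"
      using that a by (auto simp: in_quiver_polytope_star \<theta>')
    then show ?thesis by (cases b) (auto simp: a)
  qed
  have src: "(\<Sum>a\<in>arrows_at G v. y $ a) = - real_of_int (\<theta>' (Inl v))" if "y \<in> ?P" "v \<in> verts G" for y v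
    using that by (simp add: in_quiver_polytope_star)
  have range: "\<theta>' (Inl v) = -1 \<or> \<theta>' (Inl v) = -2" if v: "v \<in> verts G" for v
  proof -
    have "arrows_at G v \<noteq> {}" using at3[OF v] by auto
    then obtain a where a: "a \<in> arrows_at G v" by blast
    have sub: "arrows_at G v \<subseteq> arcs G \<times> UNIV" by (auto simp: arrows_at_def)
    have "(\<Sum>b\<in>arrows_at G v. p $ b) \<ge> 0"
      using box[OF p] sub by (intro sum_nonneg) auto
    moreover have "(\<Sum>b\<in>arrows_at G v. p $ b) \<le> (\<Sum>b\<in>arrows_at G v. 1)"
      using box[OF p] sub by (intro sum_mono) auto
    ultimately have "- 3 \<le> \<theta>' (Inl v)" "\<theta>' (Inl v) \<le> 0"
      using src[OF p v] at3[OF v] by auto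
    moreover have "\<theta>' (Inl v) \<noteq> 0"
    proof
      assume 0: "\<theta>' (Inl v) = 0"
      have "y $ a = 0" if y: "y \<in> ?P" for y
      proof (rule sum_nonneg_0[OF _ _ _ a])
        show "(\<Sum>b\<in>arrows_at G v. y $ b) = 0" using src[OF y v] 0 by simp
        show "0 \<le> y $ b" if "b \<in> arrows_at G v" for b using box[OF y] sub that by blast
      qed simp
      then show False using varies[of a 0] a sub by auto
    qed
    moreover have "\<theta>' (Inl v) \<noteq> - 3"
    proof
      assume 3: "\<theta>' (Inl v) = - 3"
      have "y $ a = 1" if y: "y \<in> ?P" for y
      proof -
        have "1 - y $ a = 0"
        proof (rule sum_nonneg_0[OF _ _ _ a])
          show "(\<Sum>b\<in>arrows_at G v. 1 - y $ b) = 0"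
            using src[OF y v] 3 at3[OF v] by (simp add: sum_subtractf)
          show "0 \<le> 1 - y $ b" if "b \<in> arrows_at G v" for b
            using box[OF y, of b] sub that by auto
        qed simp
        then show ?thesis by simp
      qed
      then show False using varies[of a 1] a sub by auto
    qed
    ultimately show ?thesis by linarith
  qed
  define S where "S = {v \<in> verts G. \<theta>' (Inl v) = -1}"
  have S: "S \<subseteq> verts G" by (auto simp: S_def)
  have vals: "\<theta>' (Inl v) = (if v \<in> S then -1 else -2)" if "v \<in> verts G" for v
    using range[OF that] that by (auto simp: S_def)
  \<comment> \<open>The total inflow at the sinks, which is 1 for each edge, equals the total outflow at the sources.\<close>
  have "real (card (arcs G)) = (\<Sum>e\<in>arcs G. p $ (e, False) + p $ (e, True))"
    using p by (simp add: in_quiver_polytope_star \<theta>')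
  also have "\<dots> = (\<Sum>v\<in>verts G. - real_of_int (\<theta>' (Inl v)))"
    using sum_over_arrows_at[OF G, of "($) p"] src[OF p] by simp
  also have "\<dots> = (\<Sum>v\<in>verts G. if v \<in> S then 1 else 2)"
    by (rule sum.cong) (auto simp: vals)
  also have "\<dots> = real (card S) + 2 * real (card (verts G - S))"
    using S by (simp add: sum.If_cases Int_absorb1 Diff_eq)
  finally have "card (arcs G) = card S + 2 * card (verts G - S)"
    by linarith
  moreover have "card S + card (verts G - S) = card (verts G)"
    using S card_Diff_subset[of S "verts G"] card_mono[of "verts G" S] finite_subset[of S "verts G"] by simp
  ultimately have "card S = d - 1" "card (verts G - S) = d - 1"
    using cardE cardV by auto
  then show ?thesis
    using \<theta>' S vals equiv by (intro exI[of _ \<theta>'] exI[of _ S]) auto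
qed

theorem theorem4p8:
  shows
    "(\<forall>(G :: ('v, 'e::finite) pre_digraph) (\<theta> :: 'v + 'e \<Rightarrow> int) (k :: 'e \<times> bool \<Rightarrow> nat).
        fin_digraph G \<and> quiver_cell (star_quiver G) \<theta> k \<noteq> {} \<longrightarrow>
        (\<exists>(H :: ('v, 'e) pre_digraph) (\<theta>' :: 'v + 'e \<Rightarrow> int).
          spanning H G \<and>
          (\<forall>e\<in>arcs H. \<theta>' (Inr e) = 1) \<and>
          integral_affine_equiv
            (quiver_lattice (star_quiver G)) (quiver_cell (star_quiver G) \<theta> k)
            (quiver_lattice (star_quiver H)) (quiver_polytope (star_quiver H) \<theta>') \<and>
          (prime_graph G \<and>
             aff_dim (quiver_cell (star_quiver G) \<theta> k) = quiver_chi (star_quiver G) \<longrightarrow> H = G)))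
     \<and>
     (\<forall>(d :: nat) (G :: ('v, 'e) pre_digraph) (\<theta> :: 'v + 'e \<Rightarrow> int) (k :: 'e \<times> bool \<Rightarrow> nat).
        2 \<le> d \<and> fin_digraph G \<and> prime_graph G \<and> regular3_graph G \<and>
        card (verts G) = 2 * d - 2 \<and>
        aff_dim (quiver_cell (star_quiver G) \<theta> k) = int d \<longrightarrow>
        (\<exists>(\<theta>' :: 'v + 'e \<Rightarrow> int) S.
          (\<forall>e\<in>arcs G. \<theta>' (Inr e) = 1) \<and>
          S \<subseteq> verts G \<and> card S = d - 1 \<and> card (verts G - S) = d - 1 \<and>
          (\<forall>v\<in>S. \<theta>' (Inl v) = -1) \<and> (\<forall>v\<in>verts G - S. \<theta>' (Inl v) = -2) \<and>
          integral_affine_equiv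
            (quiver_lattice (star_quiver G)) (quiver_cell (star_quiver G) \<theta> k)
            (quiver_lattice (star_quiver G)) (quiver_polytope (star_quiver G) \<theta>')))"
  by (intro conjI allI impI; elim conjE)
    ((rule quiver_cell_equiv_unit_sinks; assumption), (rule quiver_cell_cubic; assumption))

end
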